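(* Let $V$ be a finite set with $n=|V|$ and let $d$ be a nonnegative integer. Given value-oracle access to a posimodular function $f:2^V\to\{0,1,\dots,d\}$ with $f(\emptyset)=0$, a nonempty subset $X^*\subseteq V$ with $f(X^* )=\min\{f(X)\mid \emptyset\neq X\subseteq V\}$ (and the value $f(X^* )$) can be computed in $O(n^dT_f+n^{2d+1})$ time.
   Context: A set function $f:2^V\to\mathbb{R}$ is posimodular if $f(X)+f(Y)\ge f(X\setminus Y)+f(Y\setminus X)$ for all $X,Y\subseteq V$. $T_f$ denotes the time needed to evaluate $f(X)$ for a given $X\subseteq V$. *)

theory Defs
  imports Complex_Main "HOL-Library.FuncSet"
begin

definition posimodular_on :: "'a set \<Rightarrow> ('a set \<Rightarrow> real) \<Rightarrow> bool" where
  "posimodular_on V f \<longleftrightarrow>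
     (\<forall>X Y. X \<subseteq> V \<longrightarrow> Y \<subseteq> V \<longrightarrow> f X + f Y \<ge> f (X - Y) + f (Y - X))"

text \<open>
  Model of computation: a random access machine with a value oracle, presented as a structured
  language with big-step semantics.  A program uses finitely many registers and finitely many
  arrays (all holding natural numbers, arrays being indexed by register contents); these can be
  interleaved in one RAM memory with constant overhead.  The only arithmetic is \<open>+ 1\<close> and \<open>- 1\<close>,
  so after \<open>t\<close> steps the contents of a cell exceed the constants, inputs and oracle answers
  by at most \<open>t\<close>, and the unit-cost measure cannot be exploited by operating on huge numbers.
  A time bound on this machine is in particular one for the usual RAM with unit-cost addition and
  subtraction.
\<close>

type_synonym vname = string
type_synonym aname = string

datatype com =
    Skip
  | Const vname nat             (* x := k *)
  | Copy vname vname            (* x := y *)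
  | Inc vname
  | Dec vname                   (* truncated at 0 *)
  | Load vname aname vname      (* x := a[i] *)
  | Store aname vname vname     (* a[i] := x *)
  | Query vname aname           (* x := oracle value of the set stored in a *)
  | Seq com com
  | IfLess vname vname com com
  | WhileLess vname vname com

record state =
  var :: "vname \<Rightarrow> nat"
  arr :: "aname \<Rightarrow> nat \<Rightarrow> nat"

text \<open>The subset of \<open>{0..<n}\<close> whose characteristic vector is stored in the array \<open>a\<close>.\<close>

definition stored_set :: "nat \<Rightarrow> state \<Rightarrow> aname \<Rightarrow> nat set" where
  "stored_set n s a = {i. i < n \<and> arr s a i \<noteq> 0}"

text \<open>
  \<open>exec n g T c s t s'\<close>: started in \<open>s\<close> with ground set \<open>{0..<n}\<close> and value oracle \<open>g\<close>, the
  program \<open>c\<close> halts in \<open>s'\<close> after time \<open>t\<close>.  Each instruction and each test takes one time unit;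
  an oracle call takes \<open>T\<close> further units, which cover reading the queried set from its array.
\<close>

inductive exec ::
  "nat \<Rightarrow> (nat set \<Rightarrow> nat) \<Rightarrow> nat \<Rightarrow> com \<Rightarrow> state \<Rightarrow> nat \<Rightarrow> state \<Rightarrow> bool"
  for n :: nat and g :: "nat set \<Rightarrow> nat" and T :: nat
where
  Skip: "exec n g T Skip s 1 s"
| Const: "exec n g T (Const x k) s 1 (s\<lparr>var := (var s)(x := k)\<rparr>)"
| Copy: "exec n g T (Copy x y) s 1 (s\<lparr>var := (var s)(x := var s y)\<rparr>)"
| Inc: "exec n g T (Inc x) s 1 (s\<lparr>var := (var s)(x := var s x + 1)\<rparr>)"
| Dec: "exec n g T (Dec x) s 1 (s\<lparr>var := (var s)(x := var s x - 1)\<rparr>)"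
| Load: "exec n g T (Load x a i) s 1 (s\<lparr>var := (var s)(x := arr s a (var s i))\<rparr>)"
| Store: "exec n g T (Store a i x) s 1
    (s\<lparr>arr := (arr s)(a := (arr s a)(var s i := var s x))\<rparr>)"
| Query: "exec n g T (Query x a) s (1 + T)
    (s\<lparr>var := (var s)(x := g (stored_set n s a))\<rparr>)"
| Seq: "\<lbrakk>exec n g T c1 s t1 s'; exec n g T c2 s' t2 s''\<rbrakk>
    \<Longrightarrow> exec n g T (Seq c1 c2) s (t1 + t2) s''"
| IfTrue: "\<lbrakk>var s x < var s y; exec n g T c1 s t s'\<rbrakk>
    \<Longrightarrow> exec n g T (IfLess x y c1 c2) s (1 + t) s'"
| IfFalse: "\<lbrakk>\<not> var s x < var s y; exec n g T c2 s t s'\<rbrakk>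
    \<Longrightarrow> exec n g T (IfLess x y c1 c2) s (1 + t) s'"
| WhileFalse: "\<not> var s x < var s y \<Longrightarrow> exec n g T (WhileLess x y c) s 1 s"
| WhileTrue: "\<lbrakk>var s x < var s y; exec n g T c s t1 s'; exec n g T (WhileLess x y c) s' t2 s''\<rbrakk>
    \<Longrightarrow> exec n g T (WhileLess x y c) s (1 + t1 + t2) s''"

text \<open>The machine is deterministic, so the run, its time and its result are unique.\<close>

lemma exec_deterministic:
  "exec n g T c s t s' \<Longrightarrow> exec n g T c s u s'' \<Longrightarrow> t = u \<and> s' = s''"
proof (induction arbitrary: u s'' rule: exec.induct)
  case Skip
  then show ?case by (cases rule: exec.cases) simp_all
next
  case Const
  then show ?case by (cases rule: exec.cases) simp_all
next
  case Copy
  then show ?case by (cases rule: exec.cases) simp_all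
next
  case Inc
  then show ?case by (cases rule: exec.cases) simp_all
next
  case Dec
  then show ?case by (cases rule: exec.cases) simp_all
next
  case Load
  then show ?case by (cases rule: exec.cases) simp_all
next
  case Store
  then show ?case by (cases rule: exec.cases) simp_all
next
  case Query
  then show ?case by (cases rule: exec.cases) simp_all
next
  case (Seq c1 s t1 s1 c2 t2 s2)
  from Seq.prems obtain v1 r v2
    where u: "u = v1 + v2" and 1: "exec n g T c1 s v1 r" and 2: "exec n g T c2 r v2 s''"
    by (cases rule: exec.cases) simp_all
  from Seq.IH(1)[OF 1] have r: "t1 = v1" "s1 = r" by simp_all
  from 2 have "exec n g T c2 s1 v2 s''" by (simp only: r)
  from Seq.IH(2)[OF this] u r show ?case by simp
next
  case (IfTrue s x y c1 t s1 c2)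
  from IfTrue.prems IfTrue.hyps(1) obtain v where u: "u = 1 + v" and 1: "exec n g T c1 s v s''"
    by (cases rule: exec.cases) simp_all
  from IfTrue.IH[OF 1] u show ?case by simp
next
  case (IfFalse s x y c2 t s1 c1)
  from IfFalse.prems IfFalse.hyps(1) obtain v where u: "u = 1 + v" and 1: "exec n g T c2 s v s''"
    by (cases rule: exec.cases) simp_all
  from IfFalse.IH[OF 1] u show ?case by simp
next
  case (WhileFalse s x y c)
  from WhileFalse.prems WhileFalse.hyps show ?case by (cases rule: exec.cases) simp_all
next
  case (WhileTrue s x y c t1 s1 t2 s2)
  from WhileTrue.prems WhileTrue.hyps(1) obtain v1 r v2
    where u: "u = 1 + v1 + v2" and 1: "exec n g T c s v1 r"
      and 2: "exec n g T (WhileLess x y c) r v2 s''"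
    by (cases rule: exec.cases) simp_all
  from WhileTrue.IH(1)[OF 1] have r: "t1 = v1" "s1 = r" by simp_all
  from 2 have "exec n g T (WhileLess x y c) s1 v2 s''" by (simp only: r)
  from WhileTrue.IH(2)[OF this] u r show ?case by simp
qed

text \<open>The only inputs besides the oracle are the numbers \<open>n\<close> and \<open>d\<close>; all other memory is zero.\<close>

definition init_state :: "nat \<Rightarrow> nat \<Rightarrow> state" where
  "init_state n d = \<lparr>var = (\<lambda>_. 0)(''n'' := n, ''d'' := d), arr = (\<lambda>_ _. 0)\<rparr>"

end

theory Submission
  imports Defs
begin

text \<open>
  Let \<open>X\<close> be an inclusion-minimal minimiser with at least two elements.  Posimodularity, applied to
  \<open>X\<close> and \<open>Q \<union> R\<close>, shows \<open>f Q < f (Q \<union> R)\<close> for all \<open>Q\<close> disjoint from \<open>X\<close> and all nonempty proper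
  subsets \<open>R\<close> of \<open>X\<close>.  Starting from \<open>{}\<close>, add elements outside \<open>X\<close> as long as this increases \<open>f\<close>.
  The resulting \<open>Q\<close> satisfies \<open>card Q \<le> f Q < d\<close>, and \<open>X\<close> consists of exactly those \<open>r\<close> with
  \<open>f Q < f (insert r Q)\<close>.  Hence it suffices to evaluate \<open>f\<close> on the singletons and on the sets
  determined in this way by the sets \<open>Q\<close> with fewer than \<open>d\<close> elements, which takes \<open>n + 2\<close> queries
  for each \<open>Q\<close>.
\<close>

section \<open>Extreme sets of posimodular functions\<close>

text \<open>An \<open>r\<close> in \<open>Q\<close> fails the strict inequality because
  \<open>insert r Q = Q\<close>, so the set is automatically disjoint from \<open>Q\<close>.\<close>

definition steepest :: "'a set \<Rightarrow> ('a set \<Rightarrow> nat) \<Rightarrow> 'a set \<Rightarrow> 'a set" where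
  "steepest V f Q = {r \<in> V. f Q < f (insert r Q)}"

lemma posimodular_on_nat:
  assumes "posimodular_on V (\<lambda>X. real (f X))" "X \<subseteq> V" "Y \<subseteq> V"
  shows "f (X - Y) + f (Y - X) \<le> f X + f Y"
proof -
  have "real (f (X - Y)) + real (f (Y - X)) \<le> real (f X) + real (f Y)"
    using assms by (auto simp: posimodular_on_def)
  then show ?thesis by linarith
qed

text \<open>The two differences of \<open>X\<close> and \<open>Q \<union> R\<close> are
  \<open>X - R\<close> and \<open>Q\<close>. Extremeness makes \<open>f (X - R)\<close> exceed
  \<open>f X\<close>, so posimodularity forces \<open>f (Q \<union> R)\<close> above
  \<open>f Q\<close>.\<close>

lemma less_union_if_extreme:
  fixes f :: "'a set \<Rightarrow> nat"
  assumes pos: "posimodular_on V (\<lambda>X. real (f X))"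
    and X: "X \<subseteq> V" and extreme: "\<And>Y. Y \<subset> X \<Longrightarrow> Y \<noteq> {} \<Longrightarrow> f X < f Y"
    and Q: "Q \<subseteq> V - X" and R: "R \<subset> X" "R \<noteq> {}"
  shows "f Q < f (Q \<union> R)"
proof -
  have "f (X - (Q \<union> R)) + f ((Q \<union> R) - X) \<le> f X + f (Q \<union> R)"
    using Q R X by (intro posimodular_on_nat[OF pos]) auto
  moreover have "(Q \<union> R) - X = Q" "X - (Q \<union> R) = X - R" using Q R by auto
  moreover have "f X < f (X - R)" using R by (intro extreme) auto
  ultimately show ?thesis by simp
qed

lemma extreme_eq_steepest:
  fixes f :: "'a set \<Rightarrow> nat"
  assumes fin: "finite V" and pos: "posimodular_on V (\<lambda>X. real (f X))"
    and bound: "\<And>Y. Y \<subseteq> V \<Longrightarrow> f Y \<le> d"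
    and X: "X \<subseteq> V" and extreme: "\<And>Y. Y \<subset> X \<Longrightarrow> Y \<noteq> {} \<Longrightarrow> f X < f Y"
    and nontriv: "X \<noteq> {}" "\<And>x. X \<noteq> {x}"
  obtains Q where "Q \<subseteq> V" "card Q < d" "X = steepest V f Q"
proof -
  \<comment> \<open>\<open>F\<close> keeps only the invariant of the greedy process. For a member of
    maximal cardinality no element outside \<open>X\<close> can raise \<open>f\<close>: as
    \<open>f\<close> is integer-valued, a strict increase would pay for the added element.\<close>
  define F where "F = {Q. Q \<subseteq> V - X \<and> card Q \<le> f Q}"
  have "finite F" using fin by (auto simp: F_def intro: finite_subset[of _ "Pow V"])
  moreover have "{} \<in> F" by (simp add: F_def)
  ultimately have fc: "finite (card ` F)" "card ` F \<noteq> {}" by auto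
  from Max_in[OF this] obtain Q where Q: "Q \<in> F" "card Q = Max (card ` F)" by auto
  have maxi: "card Q' \<le> card Q" if "Q' \<in> F" for Q'
    using fc(1) that unfolding Q(2) by (intro Max_ge) auto
  have QV: "Q \<subseteq> V - X" "card Q \<le> f Q" and finQ: "finite Q"
    using Q(1) fin by (auto simp: F_def intro: finite_subset)
  have up: "f Q < f (insert r Q)" if "r \<in> X" for r
  proof -
    \<comment> \<open>As \<open>X\<close> is not a singleton, \<open>{r}\<close> is a proper subset
      of \<open>X\<close> and can serve as \<open>R\<close>.\<close>
    have "f Q < f (Q \<union> {r})"
      using that nontriv QV by (intro less_union_if_extreme[OF pos X extreme]) auto
    then show ?thesis by simp
  qed
  have down: "f (insert y Q) \<le> f Q" if "y \<in> V - X" for y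
  proof (rule ccontr)
    assume "\<not> ?thesis"
    then have "y \<notin> Q" by (auto simp: insert_absorb)
    with \<open>\<not> ?thesis\<close> have "insert y Q \<in> F" using that QV finQ by (simp add: F_def)
    from maxi[OF this] \<open>y \<notin> Q\<close> finQ show False by simp
  qed
  have "X = steepest V f Q"
    using up down X by (fastforce simp: steepest_def)
  moreover obtain r where "r \<in> X" using nontriv by blast
  \<comment> \<open>\<open>card Q \<le> f Q < f (insert r Q) \<le> d\<close>; the strictness is what
    later allows \<open>d - 1\<close> digits to suffice.\<close>
  then have "f Q < d" using up[of r] bound[of "insert r Q"] QV X by fastforce
  ultimately show ?thesis using QV by (intro that[of Q]) auto
qed

text \<open>It suffices to look at inclusion-minimal minimisers, which are extreme.\<close>

lemma lower_bound_if_candidates: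
  fixes f :: "'a set \<Rightarrow> nat"
  assumes fin: "finite V" and pos: "posimodular_on V (\<lambda>X. real (f X))"
    and bound: "\<And>Y. Y \<subseteq> V \<Longrightarrow> f Y \<le> d"
    and singl: "\<And>x. x \<in> V \<Longrightarrow> v \<le> f {x}"
    and steep: "\<And>Q. Q \<subseteq> V \<Longrightarrow> card Q < d \<Longrightarrow> steepest V f Q \<noteq> {} \<Longrightarrow> v \<le> f (steepest V f Q)"
    and Y: "Y \<subseteq> V" "Y \<noteq> {}"
  shows "v \<le> f Y"
proof -
  have "finite Y" using Y fin by (auto intro: finite_subset)
  then show ?thesis using Y
  proof (induction Y rule: finite_psubset_induct)
    case (psubset Y)
    show ?case
    proof (cases "\<exists>Z. Z \<subset> Y \<and> Z \<noteq> {} \<and> f Z \<le> f Y")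
      case True
      then obtain Z where Z: "Z \<subset> Y" "Z \<noteq> {}" "f Z \<le> f Y" by blast
      with psubset have "v \<le> f Z" by auto
      with Z show ?thesis by linarith
    next
      \<comment> \<open>Now \<open>Y\<close> is extreme, hence a singleton or a steepest
        set.\<close>
      case False
      show ?thesis
      proof (cases "\<exists>x. Y = {x}")
        case True
        with singl psubset.prems show ?thesis by auto
      next
        case nontriv: False
        obtain Q where "Q \<subseteq> V" "card Q < d" "Y = steepest V f Q"
          by (rule extreme_eq_steepest[OF fin pos bound psubset.prems(1)])
            (use False nontriv psubset.prems in \<open>auto simp: not_le\<close>)
        with steep psubset.prems show ?thesis by blast
      qed
    qed
  qed
qed

section \<open>Enumerating small sets by digit sequences\<close>

definition digits :: "nat \<Rightarrow> nat \<Rightarrow> nat \<Rightarrow> nat set" where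
  "digits n D m = {m div n ^ j mod n |j. j < D}"

text \<open>Horner's scheme: the head of the list becomes the least significant digit, the tail
  gives the quotient by \<open>n\<close>.\<close>

lemma ex_digits_list:
  fixes ls :: "nat list"
  assumes "set ls \<subseteq> {..<n}"
  shows "\<exists>m < n ^ length ls. \<forall>j < length ls. m div n ^ j mod n = ls ! j"
  using assms
proof (induction ls)
  case (Cons a ls)
  then obtain m where m: "m < n ^ length ls" "\<And>j. j < length ls \<Longrightarrow> m div n ^ j mod n = ls ! j"
    by auto
  have a: "a < n" using Cons by simp
  have "a + n * m < n * Suc m" using a by simp
  also have "\<dots> \<le> n * n ^ length ls" using m(1) by (intro mult_le_mono2) simp
  finally have "a + n * m < n ^ length (a # ls)" by simp
  moreover have "(a + n * m) div n ^ j mod n = (a # ls) ! j" if "j < length (a # ls)" for j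
  proof (cases j)
    case 0
    with a show ?thesis by simp
  next
    case (Suc i)
    have "(a + n * m) div n ^ j = (a + n * m) div n div n ^ i"
      by (simp add: Suc div_mult2_eq)
    also have "(a + n * m) div n = m" using a by simp
    finally show ?thesis using m(2)[of i] that Suc by simp
  qed
  ultimately show ?case by blast
qed simp

lemma ex_digits:
  assumes "Q \<subseteq> {..<n}" "Q \<noteq> {}" "card Q \<le> D"
  shows "\<exists>m < n ^ D. Q = digits n D m"
proof -
  have fin: "finite Q" using assms(1) by (rule finite_subset) simp
  then obtain ks where ks: "set ks = Q" "length ks = card Q"
    by (metis distinct_card finite_distinct_list)
  obtain a where a: "a \<in> Q" using assms(2) by blast
  \<comment> \<open>Copies of one element pad the enumeration to exactly \<open>D\<close> digits;
    this is where \<open>Q\<close> has to be nonempty.\<close>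
  define ls where "ls = ks @ replicate (D - card Q) a"
  have ls: "set ls = Q" "length ls = D" using ks a assms(3) by (auto simp: ls_def)
  then obtain m where "m < n ^ D" "\<And>j. j < D \<Longrightarrow> m div n ^ j mod n = ls ! j"
    using ex_digits_list[of ls n] assms(1) by auto
  moreover have "Q = (!) ls ` {..<D}"
    using ls by (auto simp: set_conv_nth)
  then have "Q = (\<lambda>j. m div n ^ j mod n) ` {..<D}"
    using \<open>\<And>j. j < D \<Longrightarrow> m div n ^ j mod n = ls ! j\<close> by simp
  then have "Q = digits n D m"
    by (auto simp: digits_def)
  ultimately show ?thesis by blast
qed

text \<open>Here \<open>c\<close> is the carry into position \<open>j\<close> when \<open>m\<close> is incremented in base \<open>n\<close>.\<close>

lemma carry_step:
  fixes m :: nat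
  assumes "Suc m div n ^ j = m div n ^ j + c" "c \<le> 1" "0 < n"
  shows "c = 0 \<Longrightarrow> Suc m div n ^ Suc j = m div n ^ Suc j"
    and "c = 0 \<Longrightarrow> Suc m div n ^ j mod n = m div n ^ j mod n"
    and "c = 1 \<Longrightarrow> Suc (m div n ^ j mod n) < n \<Longrightarrow> Suc m div n ^ Suc j = m div n ^ Suc j"
    and "c = 1 \<Longrightarrow> Suc (m div n ^ j mod n) < n \<Longrightarrow>
      Suc m div n ^ j mod n = Suc (m div n ^ j mod n)"
    and "c = 1 \<Longrightarrow> \<not> Suc (m div n ^ j mod n) < n \<Longrightarrow>
      Suc m div n ^ Suc j = Suc (m div n ^ Suc j)"
    and "c = 1 \<Longrightarrow> \<not> Suc (m div n ^ j mod n) < n \<Longrightarrow> Suc m div n ^ j mod n = 0"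
proof -
  have *: "k div n ^ Suc j = k div n ^ j div n" for k
    by (metis div_mult2_eq power_Suc2)
  \<comment> \<open>A digit whose successor is not below \<open>n\<close> equals
    \<open>n - 1\<close>, so it wraps to 0 and passes the carry on.\<close>
  have eq: "Suc (m div n ^ j mod n) = n"
    if "\<not> Suc (m div n ^ j mod n) < n"
    using that assms(3) by (metis Suc_leI le_neq_implies_less mod_less_divisor)
  show "c = 0 \<Longrightarrow> Suc m div n ^ Suc j = m div n ^ Suc j"
    "c = 0 \<Longrightarrow> Suc m div n ^ j mod n = m div n ^ j mod n"
    using assms by (simp_all add: * del: power_Suc)
  show "c = 1 \<Longrightarrow> Suc (m div n ^ j mod n) < n \<Longrightarrow> Suc m div n ^ Suc j = m div n ^ Suc j"
    "c = 1 \<Longrightarrow> \<not> Suc (m div n ^ j mod n) < n \<Longrightarrow>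
      Suc m div n ^ Suc j = Suc (m div n ^ Suc j)"
    using assms eq by (auto simp: * div_Suc mod_Suc simp del: power_Suc)
  show "c = 1 \<Longrightarrow> Suc (m div n ^ j mod n) < n \<Longrightarrow>
      Suc m div n ^ j mod n = Suc (m div n ^ j mod n)"
    "c = 1 \<Longrightarrow> \<not> Suc (m div n ^ j mod n) < n \<Longrightarrow> Suc m div n ^ j mod n = 0"
    using assms eq by (auto simp: mod_Suc)
qed

section \<open>Counting loops and frame conditions\<close>

definition For :: "vname \<Rightarrow> vname \<Rightarrow> com \<Rightarrow> com" where
  "For i m c = Seq (Const i 0) (WhileLess i m (Seq c (Inc i)))"

text \<open>A frame condition: \<open>W\<close> and \<open>B\<close> list the registers and arrays
  that a run may have overwritten.\<close>

definition unchanged :: "vname set \<Rightarrow> aname set \<Rightarrow> state \<Rightarrow> state \<Rightarrow> bool" where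
  "unchanged W B s s' \<longleftrightarrow>
     (\<forall>x. x \<notin> W \<longrightarrow> var s' x = var s x) \<and> (\<forall>a. a \<notin> B \<longrightarrow> arr s' a = arr s a)"

lemma stored_set_subset: "stored_set n s a \<subseteq> {..<n}"
  by (auto simp: stored_set_def)

section \<open>The program\<close>

text \<open>
  The array \<open>X\<close> holds the best set found so far, of value \<open>value\<close>; \<open>A\<close> holds the candidate under
  consideration.  \<open>D = d - 1\<close>, \<open>N = n ^ D\<close>, and the array \<open>q\<close> holds the base-\<open>n\<close> digits of the loop
  counter \<open>m < N\<close>; \<open>decode\<close> turns them into the set \<open>Q\<close>.  Counting over digit sequences instead of
  subsets produces every nonempty set of at most \<open>D\<close> elements, with repetitions, in exactly \<open>n ^ D\<close>
  rounds; the empty set is tried separately.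
  The register \<open>zero\<close> is never assigned, so it keeps its initial value.
\<close>

definition improve :: com where
  "improve = Seq (Query ''v'' ''A'') (IfLess ''v'' ''value''
     (Seq (Copy ''value'' ''v'')
        (For ''i'' ''n'' (Seq (Load ''x'' ''A'' ''i'') (Store ''X'' ''i'' ''x''))))
     Skip)"

text \<open>Entry \<open>r\<close> of \<open>Q\<close> is saved in \<open>o\<close>, set to one for
  the query and then restored, so one array serves all queries. The flag \<open>e\<close> records
  whether the resulting set is nonempty, since the empty set must never become the
  incumbent.\<close>

definition try_steepest :: com where
  "try_steepest = Seq (Query ''b'' ''Q'') (Seq (Const ''e'' 0) (Seq
     (For ''r'' ''n'' (Seq (Load ''o'' ''Q'' ''r'') (Seq (Store ''Q'' ''r'' ''one'')
        (Seq (Query ''v'' ''Q'') (Seq (Store ''Q'' ''r'' ''o'')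
        (IfLess ''b'' ''v'' (Seq (Store ''A'' ''r'' ''one'') (Const ''e'' 1))
           (Store ''A'' ''r'' ''zero'')))))))
     (IfLess ''zero'' ''e'' improve Skip)))"

definition singletons :: com where
  "singletons = For ''r'' ''n'' (Seq (Store ''A'' ''r'' ''one'')
     (Seq improve (Store ''A'' ''r'' ''zero'')))"

text \<open>Multiplication by \<open>n\<close> is done through unit increments: \<open>M\<close>
  grows to \<open>n * N\<close> while \<open>N\<close> stays fixed as the inner loop bound.\<close>

definition power_N :: com where
  "power_N = Seq (Const ''N'' 1) (For ''j'' ''D'' (Seq (Const ''M'' 0)
     (Seq (For ''i'' ''n'' (For ''k'' ''N'' (Inc ''M''))) (Copy ''N'' ''M''))))"

definition decode :: com where
  "decode = Seq (For ''i'' ''n'' (Store ''Q'' ''i'' ''zero''))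
     (For ''j'' ''D'' (Seq (Load ''x'' ''q'' ''j'') (Store ''Q'' ''x'' ''one'')))"

text \<open>The register \<open>c\<close> is the carry. All \<open>D\<close> positions are visited
  even after the carry has been absorbed.\<close>

definition odometer :: com where
  "odometer = Seq (Const ''c'' 1) (For ''j'' ''D'' (Seq (Load ''x'' ''q'' ''j'')
     (IfLess ''zero'' ''c'' (Seq (Inc ''x'') (IfLess ''x'' ''n''
        (Seq (Store ''q'' ''j'' ''x'') (Const ''c'' 0))
        (Store ''q'' ''j'' ''zero''))) Skip)))"

definition search :: com where
  "search = Seq singletons (Seq try_steepest (Seq power_N
     (For ''m'' ''N'' (Seq decode (Seq try_steepest odometer)))))"

text \<open>Both tests are forced by the time bound. For \<open>d = 0\<close> it allows only
  constantly many queries, and for \<open>n = 1\<close> only a constant besides \<open>T\<close>,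
  whereas \<open>search\<close> queries every singleton and has loops of length \<open>D\<close>. In
  both cases \<open>{0}\<close> is already optimal.\<close>

definition minimize :: com where
  "minimize = Seq (Const ''one'' 1) (Seq (Store ''X'' ''zero'' ''one'')
     (IfLess ''zero'' ''d''
       (Seq (Query ''value'' ''X'') (Seq (Copy ''D'' ''d'') (Seq (Dec ''D'')
         (IfLess ''one'' ''n'' search Skip))))
       Skip))"

section \<open>Weakest preconditions with time\<close>

locale oracle_machine =
  fixes n :: nat and g :: "nat set \<Rightarrow> nat" and T :: nat
begin

text \<open>Total correctness: a halting run is asserted to exist, and determinism makes it the only
  one. The postcondition also receives the running time.\<close>

definition wp :: "com \<Rightarrow> (nat \<Rightarrow> state \<Rightarrow> bool) \<Rightarrow> state \<Rightarrow> bool" where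
  "wp c Q s \<longleftrightarrow> (\<exists>t s'. exec n g T c s t s' \<and> Q t s')"

lemma wp_mono: "wp c Q s \<Longrightarrow> (\<And>t s'. Q t s' \<Longrightarrow> Q' t s') \<Longrightarrow> wp c Q' s"
  by (auto simp: wp_def)

lemma wp_basic:
  "Q 1 s \<Longrightarrow> wp Skip Q s"
  "Q 1 (s\<lparr>var := (var s)(x := k)\<rparr>) \<Longrightarrow> wp (Const x k) Q s"
  "Q 1 (s\<lparr>var := (var s)(x := var s y)\<rparr>) \<Longrightarrow> wp (Copy x y) Q s"
  "Q 1 (s\<lparr>var := (var s)(x := var s x + 1)\<rparr>) \<Longrightarrow> wp (Inc x) Q s"
  "Q 1 (s\<lparr>var := (var s)(x := var s x - 1)\<rparr>) \<Longrightarrow> wp (Dec x) Q s"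
  "Q 1 (s\<lparr>var := (var s)(x := arr s a (var s i))\<rparr>) \<Longrightarrow> wp (Load x a i) Q s"
  "Q 1 (s\<lparr>arr := (arr s)(a := (arr s a)(var s i := var s x))\<rparr>) \<Longrightarrow> wp (Store a i x) Q s"
  "Q (1 + T) (s\<lparr>var := (var s)(x := g (stored_set n s a))\<rparr>) \<Longrightarrow> wp (Query x a) Q s"
  unfolding wp_def by (blast intro: exec.intros)+

lemma wp_Seq: "wp c1 (\<lambda>t1. wp c2 (\<lambda>t2. Q (t1 + t2))) s \<Longrightarrow> wp (Seq c1 c2) Q s"
  unfolding wp_def by (blast intro: exec.intros)

lemma wp_IfLess:
  "(var s x < var s y \<Longrightarrow> wp c1 (\<lambda>t. Q (1 + t)) s) \<Longrightarrow>
   (\<not> var s x < var s y \<Longrightarrow> wp c2 (\<lambda>t. Q (1 + t)) s) \<Longrightarrow> wp (IfLess x y c1 c2) Q s"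
  unfolding wp_def by (cases "var s x < var s y") (blast intro: exec.intros)+

lemmas wp_intros = wp_basic wp_Seq wp_IfLess

text \<open>As rewrite rules, the same laws let the simplifier contract the intermediate states, which
  would otherwise grow exponentially in the length of a straight-line program.\<close>

lemma wp_simps:
  "wp Skip Q s \<longleftrightarrow> Q 1 s"
  "wp (Const x k) Q s \<longleftrightarrow> Q 1 (s\<lparr>var := (var s)(x := k)\<rparr>)"
  "wp (Copy x y) Q s \<longleftrightarrow> Q 1 (s\<lparr>var := (var s)(x := var s y)\<rparr>)"
  "wp (Inc x) Q s \<longleftrightarrow> Q 1 (s\<lparr>var := (var s)(x := var s x + 1)\<rparr>)"
  "wp (Dec x) Q s \<longleftrightarrow> Q 1 (s\<lparr>var := (var s)(x := var s x - 1)\<rparr>)"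
  "wp (Load x a i) Q s \<longleftrightarrow> Q 1 (s\<lparr>var := (var s)(x := arr s a (var s i))\<rparr>)"
  "wp (Store a i x) Q s \<longleftrightarrow>
    Q 1 (s\<lparr>arr := (arr s)(a := (arr s a)(var s i := var s x))\<rparr>)"
  "wp (Query x a) Q s \<longleftrightarrow> Q (1 + T) (s\<lparr>var := (var s)(x := g (stored_set n s a))\<rparr>)"
  "wp (Seq c1 c2) Q s \<longleftrightarrow> wp c1 (\<lambda>t1. wp c2 (\<lambda>t2. Q (t1 + t2))) s"
  "wp (IfLess x y c1 c2) Q s \<longleftrightarrow>
    (if var s x < var s y then wp c1 (\<lambda>t. Q (1 + t)) s else wp c2 (\<lambda>t. Q (1 + t)) s)"
  unfolding wp_def by (subst exec.simps; auto; blast)+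

text \<open>Induction on the number \<open>K - k\<close> of remaining rounds. A round costs at most
  \<open>B + 2\<close>, for test, body and increment; the extra 1 is the final failing test. The
  body must establish the invariant for the state after the increment.\<close>

lemma wp_While_count:
  assumes step: "\<And>k s. k < K \<Longrightarrow> var s i = k \<Longrightarrow> var s m = K \<Longrightarrow> I k s \<Longrightarrow>
      wp body (\<lambda>t s'. t \<le> B \<and> var s' i = k \<and> var s' m = K \<and>
        I (Suc k) (s'\<lparr>var := (var s')(i := Suc k)\<rparr>)) s"
    and "i \<noteq> m" "var s i = k" "var s m = K" "k \<le> K" "I k s"
  shows "wp (WhileLess i m (Seq body (Inc i)))
    (\<lambda>t s'. t \<le> 1 + (K - k) * (B + 2) \<and> var s' i = K \<and> var s' m = K \<and> I K s') s"
  using assms(3-)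
proof (induction "K - k" arbitrary: k s)
  case 0
  then have "exec n g T (WhileLess i m (Seq body (Inc i))) s 1 s"
    by (intro WhileFalse) simp
  with 0 show ?case by (auto simp: wp_def)
next
  case (Suc l)
  then have "k < K" by simp
  from step[OF this Suc.prems(1,2,4)] obtain t s1 where 1: "exec n g T body s t s1" "t \<le> B"
    "var s1 i = k" "var s1 m = K" "I (Suc k) (s1\<lparr>var := (var s1)(i := Suc k)\<rparr>)"
    by (auto simp: wp_def)
  define s2 where "s2 = s1\<lparr>var := (var s1)(i := Suc k)\<rparr>"
  have 2: "exec n g T (Seq body (Inc i)) s (t + 1) s2"
    using Seq[OF 1(1) Inc, of i] 1(3) by (simp add: s2_def)
  have "wp (WhileLess i m (Seq body (Inc i)))
    (\<lambda>t s'. t \<le> 1 + (K - Suc k) * (B + 2) \<and> var s' i = K \<and> var s' m = K \<and> I K s') s2"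
    using 1 Suc.hyps(2) \<open>k < K\<close> assms(2) by (intro Suc.hyps(1)) (auto simp: s2_def)
  then obtain u s' where 3: "exec n g T (WhileLess i m (Seq body (Inc i))) s2 u s'"
    "u \<le> 1 + (K - Suc k) * (B + 2)" "var s' i = K" "var s' m = K" "I K s'"
    by (auto simp: wp_def)
  have "exec n g T (WhileLess i m (Seq body (Inc i))) s (1 + (t + 1) + u) s'"
    using Suc.prems \<open>k < K\<close> by (intro WhileTrue[OF _ 2 3(1)]) simp
  moreover have "K - k = Suc (K - Suc k)" using \<open>k < K\<close> by simp
  then have "1 + (t + 1) + u \<le> 1 + (K - k) * (B + 2)" using 1(2) 3(2) by simp
  ultimately show ?case using 3 unfolding wp_def by blast
qed

lemma wp_For:
  assumes "i \<noteq> m" "var s m = K" "I 0 (s\<lparr>var := (var s)(i := 0)\<rparr>)"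
    and step: "\<And>k s. k < K \<Longrightarrow> var s i = k \<Longrightarrow> var s m = K \<Longrightarrow> I k s \<Longrightarrow>
      wp body (\<lambda>t s'. t \<le> B \<and> var s' i = k \<and> var s' m = K \<and>
        I (Suc k) (s'\<lparr>var := (var s')(i := Suc k)\<rparr>)) s"
    and post: "\<And>t s'. t \<le> 2 + K * (B + 2) \<Longrightarrow> var s' m = K \<Longrightarrow> I K s' \<Longrightarrow> Q t s'"
  shows "wp (For i m body) Q s"
proof -
  have "wp (WhileLess i m (Seq body (Inc i)))
    (\<lambda>t s'. t \<le> 1 + (K - 0) * (B + 2) \<and> var s' i = K \<and> var s' m = K \<and> I K s')
    (s\<lparr>var := (var s)(i := 0)\<rparr>)"
    by (rule wp_While_count[where I = I, OF step]) (use assms in auto)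
  then show ?thesis
    unfolding For_def by (intro wp_intros) (erule wp_mono, rule post, auto)
qed

section \<open>Correctness and running time\<close>

definition incumbent :: "state \<Rightarrow> bool" where
  "incumbent s \<longleftrightarrow> stored_set n s ''X'' \<noteq> {} \<and> var s ''value'' = g (stored_set n s ''X'')"

definition constants :: "state \<Rightarrow> bool" where
  "constants s \<longleftrightarrow> var s ''n'' = n \<and> var s ''zero'' = 0 \<and> var s ''one'' = 1"

text \<open>The time is \<open>T + 1\<close> for the query, 2 for the test and the copied value, and
  \<open>4 * n + 2\<close> for the loop. Nonemptiness of the candidate keeps the incumbent
  nonempty.\<close>

lemma wp_improve:
  assumes "constants s" "incumbent s" "stored_set n s ''A'' \<noteq> {}"
  shows "wp improve (\<lambda>t s'. t \<le> T + 4 * n + 5 \<and>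
    unchanged {''v'', ''value'', ''i'', ''x''} {''X''} s s' \<and> incumbent s' \<and>
    var s' ''value'' \<le> var s ''value'' \<and> var s' ''value'' \<le> g (stored_set n s ''A'')) s"
  unfolding improve_def
  apply (intro wp_Seq wp_IfLess wp_basic)
   apply (rule wp_For[where K = n and B = 2 and I = "\<lambda>k s'.
      unchanged {''v'', ''value'', ''i'', ''x''} {''X''} s s' \<and>
      var s' ''value'' = g (stored_set n s ''A'') \<and> (\<forall>i<k. arr s' ''X'' i = arr s ''A'' i)"])
  subgoal by simp
  subgoal using assms by (simp add: constants_def)
  subgoal by (simp add: unchanged_def)
  subgoal by (intro wp_intros) (auto simp: unchanged_def less_Suc_eq)
  subgoal premises prems for t s'
  proof -
    have "stored_set n s' ''X'' = stored_set n s ''A''"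
      using prems by (auto simp: stored_set_def)
    with prems assms show ?thesis by (auto simp: incumbent_def)
  qed
  subgoal using assms by (auto simp: incumbent_def unchanged_def stored_set_def)
  done

text \<open>The frame omits \<open>''Q''\<close>: its entries are overwritten only temporarily, and
  each round leaves the array as it found it.\<close>

lemma wp_try_steepest:
  assumes "constants s" "incumbent s"
  shows "wp try_steepest (\<lambda>t s'. t \<le> (n + 2) * T + 14 * n + 20 \<and>
    unchanged {''b'', ''e'', ''r'', ''o'', ''v'', ''value'', ''i'', ''x''} {''A'', ''X''} s s' \<and>
    incumbent s' \<and> var s' ''value'' \<le> var s ''value'' \<and>
    (steepest {..<n} g (stored_set n s ''Q'') \<noteq> {} \<longrightarrow>
      var s' ''value'' \<le> g (steepest {..<n} g (stored_set n s ''Q'')))) s"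
proof -
  let ?S = "steepest {..<n} g (stored_set n s ''Q'')"
  show ?thesis
    unfolding try_steepest_def
    apply (intro wp_Seq wp_basic)
    apply (rule wp_For[where K = n and B = "T + 8" and I = "\<lambda>k s'.
        unchanged {''b'', ''e'', ''r'', ''o'', ''v''} {''A''} s s' \<and>
        var s' ''b'' = g (stored_set n s ''Q'') \<and>
        (\<forall>i<k. arr s' ''A'' i \<noteq> 0 \<longleftrightarrow> i \<in> ?S) \<and> (var s' ''e'' \<noteq> 0 \<longleftrightarrow> (\<exists>i<k. i \<in> ?S))"])
    subgoal by simp
    subgoal using assms by (simp add: constants_def)
    subgoal by (simp add: unchanged_def)
    subgoal premises prems for k s'
    proof -
      have c: "var s' ''one'' = Suc 0" "var s' ''zero'' = 0" "arr s' ''Q'' = arr s ''Q''"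
        using prems assms by (auto simp: unchanged_def constants_def)
      then have st: "stored_set n s' ''Q'' = stored_set n s ''Q''" by (simp add: stored_set_def)
      have k: "k \<in> ?S \<longleftrightarrow> g (stored_set n s ''Q'') < g (insert k (stored_set n s ''Q''))"
        using prems by (simp add: steepest_def)
      have ins: "stored_set n (s'\<lparr>var := v, arr := h\<rparr>) ''Q'' = insert k (stored_set n s ''Q'')"
        if "h ''Q'' = (arr s ''Q'')(k := Suc 0)" for v h
        using prems(1) that by (auto simp: stored_set_def)
      have u: "unchanged {''b'', ''e'', ''r'', ''o'', ''v''} {''A''} s s'"
        and b: "var s' ''b'' = g (stored_set n s ''Q'')"
        and a: "\<forall>i<k. arr s' ''A'' i \<noteq> 0 \<longleftrightarrow> i \<in> ?S"
        and e: "var s' ''e'' \<noteq> 0 \<longleftrightarrow> (\<exists>i<k. i \<in> ?S)" using prems(4) by blast+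
      have "k \<in> ?S \<Longrightarrow> \<exists>i<Suc k. i \<in> ?S" by blast
      moreover have "k \<notin> ?S \<Longrightarrow> (\<exists>i<Suc k. i \<in> ?S) \<longleftrightarrow> (\<exists>i<k. i \<in> ?S)"
        using less_Suc_eq by blast
      moreover have "unchanged {''b'', ''e'', ''r'', ''o'', ''v''} {''A''} s (s'\<lparr>arr := h, var := v\<rparr>)"
        if "\<forall>x. x \<notin> {''b'', ''e'', ''r'', ''o'', ''v''} \<longrightarrow> v x = var s' x"
          "\<forall>a. a \<notin> {''A''} \<longrightarrow> h a = arr s' a" for v h
        using u that by (simp add: unchanged_def)
      moreover have "\<forall>i. i \<noteq> k \<longrightarrow> i < Suc k \<longrightarrow> arr s' ''A'' i \<noteq> 0 \<longleftrightarrow> i \<in> ?S"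
        using a by (simp add: less_Suc_eq)
      ultimately show ?thesis using prems(2,3) a e k
        by (simp add: wp_simps c ins b)
    qed
    subgoal premises prems for t s'
    proof -
      note I = prems(3)
      have A: "stored_set n s' ''A'' = ?S"
        using I by (auto simp: stored_set_def steepest_def)
      have e: "var s' ''e'' \<noteq> 0 \<longleftrightarrow> ?S \<noteq> {}"
        using I by (auto simp: steepest_def)
      have s': "constants s'" "incumbent s'" "var s' ''value'' = var s ''value''"
        using I assms by (auto simp: constants_def incumbent_def unchanged_def stored_set_def)
      show ?thesis
        \<comment> \<open>\<open>improve\<close> runs only if \<open>?S\<close> is nonempty, as its
          rule demands; otherwise the claim about \<open>?S\<close> is vacuous and the incumbent
          stays.\<close>
        apply (rule wp_IfLess)
        subgoal premises less
          apply (rule wp_mono[OF wp_improve[OF s'(1,2)]])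
          subgoal using less A e by auto
          subgoal using prems(1) I s'(3) A by (simp add: unchanged_def algebra_simps)
          done
        subgoal premises not_less
        proof -
          have "?S = {}" using not_less e s'(1) by (auto simp: constants_def)
          then show ?thesis
            using prems(1) I s' by (intro wp_basic) (simp add: unchanged_def algebra_simps)
        qed
        done
    qed
    done
qed

lemma wp_singletons:
  assumes "constants s" "incumbent s" "arr s ''A'' = (\<lambda>_. 0)"
  shows "wp singletons (\<lambda>t s'. t \<le> 2 + n * (T + 4 * n + 9) \<and>
    unchanged {''r'', ''v'', ''value'', ''i'', ''x''} {''A'', ''X''} s s' \<and>
    incumbent s' \<and> (\<forall>r<n. var s' ''value'' \<le> g {r})) s"
  unfolding singletons_def
  \<comment> \<open>\<open>A\<close> is all zero between rounds, so setting one entry stores exactly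
    a singleton.\<close>
  apply (rule wp_For[where K = n and B = "T + 4 * n + 7" and I = "\<lambda>k s'.
      unchanged {''r'', ''v'', ''value'', ''i'', ''x''} {''A'', ''X''} s s' \<and>
      arr s' ''A'' = (\<lambda>_. 0) \<and> incumbent s' \<and> (\<forall>r<k. var s' ''value'' \<le> g {r})"])
  subgoal by simp
  subgoal using assms by (simp add: constants_def)
  subgoal using assms by (simp add: unchanged_def incumbent_def stored_set_def)
  subgoal premises prems for k s'
  proof -
    define s1 where "s1 = s'\<lparr>arr := (arr s')(''A'' := (arr s' ''A'')(var s' ''r'' := var s' ''one''))\<rparr>"
    have s1: "constants s1" "incumbent s1" "stored_set n s1 ''A'' = {k}" "var s1 = var s'"
      "arr s1 ''A'' = (\<lambda>_. 0)(k := 1)"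
      using prems assms
      by (auto simp: s1_def unchanged_def constants_def incumbent_def stored_set_def)
    have 1: "unchanged {} {''A''} s' s1" by (simp add: unchanged_def s1_def)
    show ?thesis
      apply (intro wp_Seq wp_basic, fold s1_def)
      apply (rule wp_mono[OF wp_improve[OF s1(1,2)]])
      subgoal using s1 by simp
      subgoal premises imp for t s2
      proof (rule wp_basic)
        let ?s3 = "s2\<lparr>arr := (arr s2)(''A'' := (arr s2 ''A'')(var s2 ''r'' := var s2 ''zero''))\<rparr>"
        let ?s4 = "?s3\<lparr>var := (var ?s3)(''r'' := Suc k)\<rparr>"
        from imp have v: "var s2 ''r'' = k" "var s2 ''zero'' = 0" "var s2 ''n'' = n"
          "arr s2 ''A'' = (\<lambda>_. 0)(k := 1)" "var s2 ''value'' \<le> var s' ''value''"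
          "var s2 ''value'' \<le> g {k}"
          using prems s1 by (auto simp: unchanged_def constants_def)
        have "unchanged {''r'', ''v'', ''value'', ''i'', ''x''} {''A'', ''X''} s ?s4"
          using imp prems 1 by (simp add: unchanged_def)
        moreover have "incumbent ?s4"
          using imp by (simp add: incumbent_def stored_set_def)
        moreover have "arr ?s4 ''A'' = (\<lambda>_. 0)" using v by auto
        moreover have "\<forall>r<Suc k. var ?s4 ''value'' \<le> g {r}"
          using v prems by (auto simp: All_less_Suc intro: order_trans)
        ultimately show "1 + (t + 1) \<le> T + 4 * n + 7 \<and> var ?s3 ''r'' = k \<and> var ?s3 ''n'' = n \<and>
          unchanged {''r'', ''v'', ''value'', ''i'', ''x''} {''A'', ''X''} s ?s4 \<and>
          arr ?s4 ''A'' = (\<lambda>_. 0) \<and> incumbent ?s4 \<and> (\<forall>r<Suc k. var ?s4 ''value'' \<le> g {r})"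
          using imp v by simp
      qed
      done
  qed
  subgoal by (simp add: algebra_simps)
  done

lemma wp_power_N:
  assumes "constants s" "var s ''D'' = D"
  shows "wp power_N (\<lambda>t s'. t \<le> 3 + D * (n * (3 * n ^ D + 4) + 6) \<and>
    unchanged {''N'', ''M'', ''i'', ''j'', ''k''} {} s s' \<and> var s' ''N'' = n ^ D) s"
  unfolding power_N_def
  apply (intro wp_Seq wp_basic)
  apply (rule wp_For[where K = D and B = "n * (3 * n ^ D + 4) + 4" and I = "\<lambda>k s'.
      unchanged {''N'', ''M'', ''i'', ''j'', ''k''} {} s s' \<and> var s' ''N'' = n ^ k"])
  subgoal by simp
  subgoal using assms by simp
  subgoal by (simp add: unchanged_def)
  subgoal premises prems for l s'
    apply (intro wp_Seq wp_basic)
    apply (rule wp_For[where K = n and B = "3 * n ^ D + 2" and I = "\<lambda>k s2.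
       unchanged {''M'', ''i'', ''k''} {} s' s2 \<and> var s2 ''M'' = k * n ^ l"])
    subgoal by simp
    subgoal using prems assms by (simp add: unchanged_def constants_def)
    subgoal by (simp add: unchanged_def)
    subgoal premises prems' for k s2
      apply (rule wp_For[where K = "n ^ l" and B = 1 and I = "\<lambda>h s3.
         unchanged {''M'', ''i'', ''k''} {} s2 s3 \<and> var s3 ''M'' = k * n ^ l + h \<and> var s3 ''i'' = k"])
      subgoal by simp
      subgoal using prems prems' by (simp add: unchanged_def)
      subgoal using prems' by (simp add: unchanged_def)
      subgoal by (intro wp_basic) (simp add: unchanged_def)
      subgoal premises post for t s3
      proof -
        \<comment> \<open>This makes the bound uniform in \<open>l\<close>. It uses
          \<open>1 \<le> n\<close>, which holds because the loop over \<open>i\<close> has been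
          entered.\<close>
        have "n ^ l \<le> n ^ D" using prems(1) prems'(1) by (intro power_increasing) auto
        then have "t \<le> 3 * n ^ D + 2" using post(1) by simp
        then show ?thesis using post(2-) prems'(2-) by (simp add: unchanged_def)
      qed
      done
    subgoal premises prems' for t s2
    proof -
      have "t \<le> 2 + n * (3 * n ^ D + 4)" using prems'(1) by (simp add: algebra_simps)
      then show ?thesis
        using prems(2-) prems'(2-) by (simp add: wp_simps unchanged_def)
    qed
    done
  subgoal by (simp add: algebra_simps)
  done

lemma wp_decode:
  assumes "constants s" "var s ''D'' = D" "\<forall>j<D. arr s ''q'' j = m div n ^ j mod n" "0 < n"
  shows "wp decode (\<lambda>t s'. t \<le> 4 + 3 * n + 4 * D \<and>
    unchanged {''i'', ''j'', ''x''} {''Q''} s s' \<and> stored_set n s' ''Q'' = digits n D m) s"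
  unfolding decode_def
  apply (rule wp_Seq)
  apply (rule wp_For[where K = n and B = 1 and I = "\<lambda>k s'.
      unchanged {''i'', ''j'', ''x''} {''Q''} s s' \<and> (\<forall>i<k. arr s' ''Q'' i = 0)"])
  subgoal by simp
  subgoal using assms by (simp add: constants_def)
  subgoal by (simp add: unchanged_def)
  subgoal using assms by (intro wp_basic) (auto simp: unchanged_def constants_def All_less_Suc)
  subgoal premises prems for t s'
    apply (rule wp_For[where K = D and B = 2 and I = "\<lambda>k s'.
      unchanged {''i'', ''j'', ''x''} {''Q''} s s' \<and> stored_set n s' ''Q'' = digits n k m"])
    subgoal by simp
    subgoal using prems assms by (simp add: unchanged_def)
    subgoal using prems by (simp add: unchanged_def digits_def stored_set_def)
    subgoal premises prems' for k s'
    proof -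
      have "digits n (Suc k) m = insert (m div n ^ k mod n) (digits n k m)"
        by (auto simp: digits_def less_Suc_eq)
      moreover have "stored_set n (s'\<lparr>arr := (arr s')(''Q'' := (arr s' ''Q'')(x := Suc 0))\<rparr>) ''Q''
        = insert x (stored_set n s' ''Q'')" if "x < n" for x s'
        using that by (auto simp: stored_set_def)
      ultimately show ?thesis
        using prems' assms by (intro wp_Seq wp_basic) (auto simp: unchanged_def constants_def stored_set_def)
    qed
    subgoal using prems by simp
    done
  done

lemma wp_odometer:
  assumes "constants s" "var s ''D'' = D" "\<forall>j<D. arr s ''q'' j = m div n ^ j mod n" "0 < n"
  shows "wp odometer (\<lambda>t s'. t \<le> 3 + 10 * D \<and>
    unchanged {''c'', ''j'', ''x''} {''q''} s s' \<and>
    (\<forall>j<D. arr s' ''q'' j = Suc m div n ^ j mod n)) s"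
  unfolding odometer_def
  apply (intro wp_Seq wp_basic)
  \<comment> \<open>Positions below \<open>k\<close> already show \<open>Suc m\<close>, the others
    still \<open>m\<close>, and \<open>c\<close> is the carry into position \<open>k\<close>,
    initially 1. A carry out of the last position is dropped, which leaves the lower digits
    correct.\<close>
  apply (rule wp_For[where K = D and B = 8 and I = "\<lambda>k s'.
      unchanged {''c'', ''j'', ''x''} {''q''} s s' \<and>
      (\<forall>j<D. arr s' ''q'' j = (if j < k then Suc m else m) div n ^ j mod n) \<and>
      Suc m div n ^ k = m div n ^ k + var s' ''c'' \<and> var s' ''c'' \<le> 1"])
  subgoal by simp
  subgoal using assms by simp
  subgoal using assms by (simp add: unchanged_def)
  subgoal premises prems for k s'
  proof -
    note I = prems(4)
    have c: "var s' ''zero'' = 0" "var s' ''n'' = n" "arr s' ''q'' k = m div n ^ k mod n"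
      using I assms prems(1) by (auto simp: unchanged_def constants_def)
    have carry: "Suc m div n ^ k = m div n ^ k + var s' ''c''" "var s' ''c'' \<le> 1"
      and digit: "\<forall>j<D. arr s' ''q'' j = (if j < k then Suc m else m) div n ^ j mod n"
      and u: "unchanged {''c'', ''j'', ''x''} {''q''} s s'"
      using I by blast+
    have u': "unchanged {''c'', ''j'', ''x''} {''q''} s (s'\<lparr>arr := h, var := v\<rparr>)"
      "unchanged {''c'', ''j'', ''x''} {''q''} s (s'\<lparr>var := v\<rparr>)"
      if "\<forall>x. x \<notin> {''c'', ''j'', ''x''} \<longrightarrow> v x = var s' x"
        "\<forall>a. a \<notin> {''q''} \<longrightarrow> h a = arr s' a" for v h
      using u that by (simp_all add: unchanged_def)
    note step = carry_step[OF carry assms(4)]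
    consider "var s' ''c'' = 0" | "var s' ''c'' = 1" "Suc (m div n ^ k mod n) < n"
      | "var s' ''c'' = 1" "\<not> Suc (m div n ^ k mod n) < n"
      using carry(2) by linarith
    then show ?thesis
    proof cases
      case 1
      with step(1) u'(2)[where h = "arr s'"] prems(2,3) c show ?thesis
        by (simp add: wp_simps del: power_Suc) (use digit step(2) 1 in \<open>auto simp: less_Suc_eq\<close>)
    next
      case 2
      with step(3) u' prems(2,3) c show ?thesis
        by (simp add: wp_simps del: power_Suc) (use digit step(4) 2 in \<open>auto simp: less_Suc_eq\<close>)
    next
      case 3
      with step(5) u' prems(2,3) c show ?thesis
        by (simp add: wp_simps del: power_Suc) (use digit step(6) 3 in \<open>auto simp: less_Suc_eq\<close>)
    qed
  qed
  subgoal by auto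
  done

definition beats :: "state \<Rightarrow> nat set \<Rightarrow> bool" where
  "beats s Q \<longleftrightarrow> (steepest {..<n} g Q \<noteq> {} \<longrightarrow> var s ''value'' \<le> g (steepest {..<n} g Q))"

lemma beats_mono: "beats s Q \<Longrightarrow> var s' ''value'' \<le> var s ''value'' \<Longrightarrow> beats s' Q"
  by (auto simp: beats_def)

text \<open>The frame omits \<open>''m''\<close>, \<open>''N''\<close> and \<open>''D''\<close>, so
  this can serve as the body of the main loop. The time bound is the sum of those of the three
  parts.\<close>

lemma wp_search_step:
  assumes "constants s" "incumbent s" "var s ''D'' = D" "0 < n"
    "\<forall>j<D. arr s ''q'' j = m div n ^ j mod n"
  shows "wp (Seq decode (Seq try_steepest odometer)) (\<lambda>t s'.
    t \<le> (n + 2) * T + 17 * n + 14 * D + 27 \<and>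
    unchanged {''b'', ''e'', ''r'', ''o'', ''v'', ''value'', ''i'', ''x'', ''c'', ''j''}
      {''A'', ''X'', ''Q'', ''q''} s s' \<and>
    incumbent s' \<and> (\<forall>j<D. arr s' ''q'' j = Suc m div n ^ j mod n) \<and>
    var s' ''value'' \<le> var s ''value'' \<and> beats s' (digits n D m)) s"
  apply (rule wp_Seq)
  apply (rule wp_mono[OF wp_decode[OF assms(1,3,5,4)]])
  subgoal premises post1 for t1 s1
  proof -
    note time1 = post1[THEN conjunct1] and p1 = post1[THEN conjunct2]
    have s1: "constants s1" "incumbent s1" "var s1 ''D'' = D" "var s1 ''value'' = var s ''value''"
      "\<forall>j<D. arr s1 ''q'' j = m div n ^ j mod n"
      using p1 assms by (simp_all add: unchanged_def constants_def incumbent_def stored_set_def)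
    show ?thesis
      apply (rule wp_Seq)
      apply (rule wp_mono[OF wp_try_steepest[OF s1(1,2)]])
      subgoal premises post2 for t2 s2
      proof -
        note time2 = post2[THEN conjunct1] and p2 = post2[THEN conjunct2]
        have s2: "constants s2" "var s2 ''D'' = D" "\<forall>j<D. arr s2 ''q'' j = m div n ^ j mod n"
          "beats s2 (digits n D m)"
          using p1 p2 s1 by (simp_all add: unchanged_def constants_def beats_def)
        show ?thesis
          apply (rule wp_mono[OF wp_odometer[OF s2(1-3) assms(4)]])
          subgoal premises post3 for t3 s3
          proof -
            note time3 = post3[THEN conjunct1] and p3 = post3[THEN conjunct2]
            have "unchanged {''b'', ''e'', ''r'', ''o'', ''v'', ''value'', ''i'', ''x'', ''c'', ''j''}
              {''A'', ''X'', ''Q'', ''q''} s s3"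
              using p1 p2 p3 by (simp add: unchanged_def)
            moreover have "var s3 ''value'' = var s2 ''value''" "incumbent s3"
              using p2 p3 by (simp_all add: unchanged_def incumbent_def stored_set_def)
            moreover from this(1) have "beats s3 (digits n D m)" using s2(4) by (simp add: beats_def)
            ultimately show ?thesis using time1 time2 time3 p1 p2 p3 s1(4) by simp
          qed
          done
      qed
      done
  qed
  done

text \<open>The brackets bound \<open>singletons\<close>, the trial of the empty set,
  \<open>power_N\<close> and the main loop, in this order; 29 is the 27 of a round plus the loop
  overhead 2.\<close>

definition search_time :: "nat \<Rightarrow> nat" where
  "search_time D = (2 + n * (T + 4 * n + 9)) + ((n + 2) * T + 14 * n + 20) +
     (3 + D * (n * (3 * n ^ D + 4) + 6)) + (2 + n ^ D * ((n + 2) * T + 17 * n + 14 * D + 29))"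

lemma wp_search:
  assumes "constants s" "incumbent s" "var s ''D'' = D" "0 < n"
    and arrays: "arr s ''A'' = (\<lambda>_. 0)" "arr s ''Q'' = (\<lambda>_. 0)" "arr s ''q'' = (\<lambda>_. 0)"
  shows "wp search (\<lambda>t s'. t \<le> search_time D \<and> incumbent s' \<and>
    (\<forall>r<n. var s' ''value'' \<le> g {r}) \<and>
    (\<forall>Q. Q \<subseteq> {..<n} \<longrightarrow> card Q \<le> D \<longrightarrow> beats s' Q)) s"
  unfolding search_def
  apply (rule wp_Seq)
  apply (rule wp_mono[OF wp_singletons[OF assms(1,2) arrays(1)]])
  subgoal premises post1 for t1 s1
  proof -
    note time1 = post1[THEN conjunct1] and p1 = post1[THEN conjunct2]
    have s1: "constants s1" "incumbent s1" "var s1 ''D'' = D" "arr s1 ''q'' = (\<lambda>_. 0)"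
      "stored_set n s1 ''Q'' = {}"
      using p1 assms by (simp_all add: unchanged_def constants_def stored_set_def)
    show ?thesis
      apply (rule wp_Seq)
      apply (rule wp_mono[OF wp_try_steepest[OF s1(1,2)]])
      subgoal premises post2 for t2 s2
      proof -
        note time2 = post2[THEN conjunct1] and p2 = post2[THEN conjunct2]
        have s2: "constants s2" "incumbent s2" "var s2 ''D'' = D" "arr s2 ''q'' = (\<lambda>_. 0)"
          "beats s2 {}"
          using p1 p2 s1 by (simp_all add: unchanged_def constants_def beats_def)
        have singles: "\<forall>r<n. var s2 ''value'' \<le> g {r}"
          using p1 p2 by (meson order_trans)
        show ?thesis
          apply (rule wp_Seq)
          apply (rule wp_mono[OF wp_power_N[OF s2(1,3)]])
          subgoal premises post3 for t3 s3
          proof -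
            note time3 = post3[THEN conjunct1] and p3 = post3[THEN conjunct2]
            have s3: "constants s3" "incumbent s3" "var s3 ''D'' = D" "arr s3 ''q'' = (\<lambda>_. 0)"
              "var s3 ''value'' = var s2 ''value''"
              using p3 s2
              by (simp_all add: unchanged_def constants_def incumbent_def stored_set_def)
            show ?thesis
              \<comment> \<open>The fresh array \<open>q\<close> holds the digits of 0. As
                \<open>value\<close> only decreases, candidates beaten earlier stay beaten.\<close>
              apply (rule wp_For[where K = "n ^ D" and
                B = "(n + 2) * T + 17 * n + 14 * D + 27" and I = "\<lambda>m s'.
                constants s' \<and> incumbent s' \<and> var s' ''D'' = D \<and>
                (\<forall>j<D. arr s' ''q'' j = m div n ^ j mod n) \<and>
                var s' ''value'' \<le> var s2 ''value'' \<and> (\<forall>m'<m. beats s' (digits n D m'))"])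
              subgoal by simp
              subgoal using p3 by simp
              subgoal using s3 by (simp add: constants_def incumbent_def stored_set_def)
              subgoal premises I for m s4
                apply (rule wp_mono[OF wp_search_step[of s4 D m]])
                subgoal using I by simp
                subgoal using I by simp
                subgoal using I by simp
                subgoal using assms by simp
                subgoal using I by simp
                subgoal premises p5 for t5 s5
                proof -
                  let ?s = "s5\<lparr>var := (var s5)(''m'' := Suc m)\<rparr>"
                  have "beats ?s (digits n D m')" if "m' < Suc m" for m'
                  proof (cases "m' = m")
                    case True
                    then show ?thesis using p5 by (simp add: beats_def)
                  next
                    case False
                    with that have "m' < m" by simp
                    then have "beats s4 (digits n D m')" using I(4) by blast
                    then show ?thesis using p5 by (rule_tac beats_mono) auto
                  qed
                  then show ?thesis using p5 I
                    by (simp add: unchanged_def constants_def incumbent_def stored_set_def)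
                qed
                done
              subgoal premises p6 for t6 s6
              proof -
                note p6' = p6(2-)
                have "beats s6 Q" if Q: "Q \<subseteq> {..<n}" "card Q \<le> D" for Q
                \<comment> \<open>The empty set was tried before the loop; every other
                  \<open>Q\<close> is coded by some \<open>m < n ^ D\<close>.\<close>
                proof (cases "Q = {}")
                  case True
                  then show ?thesis using beats_mono[OF s2(5), of s6] p6' by simp
                next
                  case False
                  then show ?thesis using ex_digits[OF Q(1) False Q(2)] p6' by auto
                qed
                moreover have "\<forall>r<n. var s6 ''value'' \<le> g {r}"
                  using singles p6' by (meson order_trans)
                moreover have "t1 + (t2 + (t3 + t6)) \<le> search_time D"
                  using add_mono[OF time1 add_mono[OF time2 add_mono[OF time3 p6(1)]]]
                  by (simp only: search_time_def add.assoc numeral_plus_numeral add_num_simps)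
                ultimately show ?thesis using p6' by blast
              qed
              done
          qed
          done
      qed
      done
  qed
  done

section \<open>The overall time bound\<close>

lemma search_time_le:
  assumes "2 \<le> n" "0 < d"
  shows "search_time (d - 1) + T + 10 \<le> 200 * (n ^ d * T + n ^ (2 * d + 1))"
proof -
  define D where "D = d - 1"
  define N where "N = n ^ D"
  \<comment> \<open>\<open>E\<close> and the later \<open>U\<close> are the two terms of the claimed
    bound, since \<open>n ^ d = n * N\<close>. Terms containing \<open>T\<close> will be charged to
    \<open>U\<close>, all others to \<open>E\<close>.\<close>
  define E where "E = n ^ 3 * N ^ 2"
  have d: "d = Suc D" using assms by (simp add: D_def)
  have nd: "n ^ d = n * N" by (simp add: d N_def)
  have E: "n ^ (2 * d + 1) = E"
    by (simp add: d E_def N_def power_mult[symmetric] power_add[symmetric] mult.commute numeral_eq_Suc)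
  have N: "1 \<le> N" using assms by (simp add: N_def)
  \<comment> \<open>Loops of length \<open>D\<close> are absorbed by
    \<open>D \<le> 2 ^ D \<le> n ^ D\<close>, which relies on \<open>2 \<le> n\<close>.\<close>
  have "D \<le> 2 ^ D" by (simp add: less_imp_le)
  also have "\<dots> \<le> N" unfolding N_def using assms by (intro power_mono) auto
  finally have D: "D \<le> N" .
  have mono: "a * b \<le> E" if "a \<le> n ^ 3" "b \<le> N ^ 2" for a b
    unfolding E_def using that by (rule mult_le_mono)
  have n: "1 \<le> n ^ 3" "n \<le> n ^ 3" "n * n \<le> n ^ 3"
    using assms self_le_power[of n 3] power_increasing[of 2 3 n] by (auto simp: power2_eq_square)
  have N2: "1 \<le> N ^ 2" "N \<le> N ^ 2" "D \<le> N ^ 2" "N * D \<le> N ^ 2"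
    using N D self_le_power[of N 2] mult_le_mono[OF order_refl D, of N]
    by (auto simp: power2_eq_square intro: order_trans)
  have le: "1 \<le> E" "n \<le> E" "n * n \<le> E" "N \<le> E" "D \<le> E" "n * N \<le> E" "n * D \<le> E"
    "N * D \<le> E" "n * (N * D) \<le> E"
    using mono[OF n(1) N2(1)] mono[OF n(2) N2(1)] mono[OF n(3) N2(1)] mono[OF n(1) N2(2)]
      mono[OF n(1) N2(3)] mono[OF n(2) N2(2)] mono[OF n(2) N2(3)] mono[OF n(1) N2(4)]
      mono[OF n(2) N2(4)] by simp_all
  define U where "U = n * N * T"
  have T: "T \<le> U" "n * T \<le> U" "N * T \<le> U"
    using N assms by (simp_all add: U_def)
  \<comment> \<open>The coefficients add up to 137 for the terms below \<open>E\<close> and to 8 for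
    those below \<open>U\<close>, so 200 is generous.\<close>
  have "search_time D + T + 10 = 4 * (n * n) + 23 * n + 37 + 3 * (n * (N * D)) + 4 * (n * D) +
      6 * D + 17 * (n * N) + 14 * (N * D) + 29 * N + 2 * (n * T) + 3 * T + 2 * (N * T) + U"
    by (simp add: search_time_def U_def flip: N_def) (simp add: algebra_simps)
  also have "\<dots> \<le> 200 * (U + E)" using le T by simp
  finally show ?thesis by (simp only: nd E D_def U_def)
qed

lemma wp_minimize:
  assumes n: "0 < n" and pos: "posimodular_on {..<n} (\<lambda>X. real (g X))"
    and bound: "\<And>Y. Y \<subseteq> {..<n} \<Longrightarrow> g Y \<le> d"
  shows "wp minimize (\<lambda>t s. t \<le> 200 * (n ^ d * T + n ^ (2 * d + 1)) \<and> incumbent s \<and>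
    (\<forall>Y. Y \<subseteq> {..<n} \<longrightarrow> Y \<noteq> {} \<longrightarrow> var s ''value'' \<le> g Y)) (init_state n d)"
proof -
  define B where "B = 200 * (n ^ d * T + n ^ (2 * d + 1))"
  let ?a = "(\<lambda>_ _. 0)(''X'' := (\<lambda>_. 0)(0 := Suc 0))"
  have stored: "stored_set n \<lparr>var = v, arr = ?a\<rparr> ''X'' = {0}" for v
    using n by (auto simp: stored_set_def)
  consider "d = 0" | "0 < d" "n = 1" | "0 < d" "2 \<le> n" using n by linarith
  then have "wp minimize (\<lambda>t s. t \<le> B \<and> incumbent s \<and>
    (\<forall>Y. Y \<subseteq> {..<n} \<longrightarrow> Y \<noteq> {} \<longrightarrow> var s ''value'' \<le> g Y)) (init_state n d)"
  proof cases
    case 1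
    \<comment> \<open>For \<open>d = 0\<close> the oracle is constantly 0, which is what the
      register \<open>value\<close> still contains.\<close>
    have "g {0} = 0" "4 \<le> B" using bound[of "{0}"] n 1 by (simp_all add: B_def)
    with 1 n show ?thesis
      by (simp add: minimize_def init_state_def wp_simps incumbent_def stored)
  next
    case 2
    have "g {0} \<le> g Y" if "Y \<subseteq> {..<n}" "Y \<noteq> {}" for Y
    proof -
      have "Y = {0}" using that 2(2) by auto
      then show ?thesis by simp
    qed
    moreover have "T + 20 \<le> B" using 2(2) by (simp add: B_def)
    moreover have "\<not> Suc 0 < n" using 2(2) by simp
    ultimately show ?thesis using 2(1)
      by (simp add: minimize_def init_state_def wp_simps incumbent_def stored)
  next
    case 3
    define v where "v = ((\<lambda>_. 0)(''n'' := n, ''d'' := d, ''one'' := Suc 0,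
      ''value'' := g {0}, ''D'' := d - 1)) "
    define s where "s = \<lparr>var = v, arr = ?a\<rparr>"
    have s: "constants s" "incumbent s" "var s ''D'' = d - 1" "arr s ''A'' = (\<lambda>_. 0)"
      "arr s ''Q'' = (\<lambda>_. 0)" "arr s ''q'' = (\<lambda>_. 0)"
      by (simp_all add: s_def v_def constants_def incumbent_def stored)
    \<comment> \<open>The summand \<open>T + 10\<close> leaves room for the instructions before
      \<open>search\<close>, among them one query.\<close>
    have "wp search (\<lambda>t s'. t + T + 10 \<le> B \<and> incumbent s' \<and>
      (\<forall>Y. Y \<subseteq> {..<n} \<longrightarrow> Y \<noteq> {} \<longrightarrow> var s' ''value'' \<le> g Y)) s"
      apply (rule wp_mono[OF wp_search[OF s(1-3) n s(4-6)]])
      subgoal premises p for t s'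
      proof -
        have "var s' ''value'' \<le> g Y" if "Y \<subseteq> {..<n}" "Y \<noteq> {}" for Y
          by (rule lower_bound_if_candidates[OF _ pos bound _ _ that])
            (use p in \<open>auto simp: beats_def\<close>)
        moreover have "search_time (d - 1) + T + 10 \<le> B"
          unfolding B_def using 3(2,1) by (rule search_time_le)
        ultimately show ?thesis using p by auto
      qed
      done
    with 3 show ?thesis
      by (simp add: minimize_def init_state_def wp_simps stored s_def v_def) (erule wp_mono, simp)
  qed
  then show ?thesis by (simp only: B_def)
qed

end

section \<open>Transfer to an arbitrary finite ground set\<close>

lemma posimodular_on_image:
  assumes "posimodular_on (h ` U) (\<lambda>X. real (f X))" "inj_on h U"
  shows "posimodular_on U (\<lambda>I. real (f (h ` I)))"
  unfolding posimodular_on_def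
proof (intro allI impI)
  fix X Y assume XY: "X \<subseteq> U" "Y \<subseteq> U"
  \<comment> \<open>Injectivity lets images commute with set differences.\<close>
  have "h ` (X - Y) = h ` X - h ` Y" "h ` (Y - X) = h ` Y - h ` X"
    by (intro inj_on_image_set_diff[OF assms(2)]; use XY in blast)+
  moreover have "h ` X \<subseteq> h ` U" "h ` Y \<subseteq> h ` U" using XY by auto
  ultimately show "real (f (h ` X)) + real (f (h ` Y))
      \<ge> real (f (h ` (X - Y))) + real (f (h ` (Y - X)))"
    using assms(1) by (simp add: posimodular_on_def)
qed

text \<open>Program and constant are chosen before the instance, hence uniform in it. The machine
  knows only indices; \<open>xs\<close> is an arbitrary numbering of \<open>V\<close> through which
  the oracle is read.\<close>

theorem theorem4:
  "\<exists>(P :: com) (C :: nat).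
     \<forall>(V :: 'a set) (xs :: 'a list) (n :: nat) (d :: nat) (f :: 'a set \<Rightarrow> nat) (T :: nat).
       finite V \<and> V \<noteq> {} \<and> n = card V \<and> distinct xs \<and> set xs = V \<and>
       f \<in> Pow V \<rightarrow> {0..d} \<and> f {} = 0 \<and> posimodular_on V (\<lambda>X. real (f X)) \<longrightarrow>
       (\<exists>t s X. exec n (\<lambda>I. f ((!) xs ` I)) T P (init_state n d) t s \<and>
          X = (!) xs ` stored_set n s ''X'' \<and>
          X \<noteq> {} \<and> X \<subseteq> V \<and>
          f X = Min {f Y |Y. Y \<noteq> {} \<and> Y \<subseteq> V} \<and>
          var s ''value'' = f X \<and>
          t \<le> C * (n ^ d * T + n ^ (2 * d + 1)))"
proof (rule exI[of _ minimize], rule exI[of _ 200], intro allI impI, elim conjE)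
  fix V :: "'a set" and xs :: "'a list" and n d :: nat and f :: "'a set \<Rightarrow> nat" and T :: nat
  assume V: "finite V" "V \<noteq> {}" "n = card V" and xs: "distinct xs" "set xs = V"
    and f: "f \<in> Pow V \<rightarrow> {0..d}" and pos: "posimodular_on V (\<lambda>X. real (f X))"
  define g where "g = (\<lambda>I. f ((!) xs ` I))"
  have n: "0 < n" using V by (simp add: card_gt_0_iff)
  have len: "length xs = n" using V(3) xs distinct_card by metis
  have bij: "bij_betw ((!) xs) {..<n} V"
    using xs len by (intro bij_betw_nth) auto
  then have inj: "inj_on ((!) xs) {..<n}" and img: "(!) xs ` {..<n} = V"
    by (auto simp: bij_betw_def)
  have "posimodular_on {..<n} (\<lambda>I. real (g I))"
    unfolding g_def using pos inj by (intro posimodular_on_image) (simp_all add: img)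
  moreover have "g I \<le> d" if "I \<subseteq> {..<n}" for I
    using f image_mono[OF that, of "(!) xs"] by (auto simp: g_def img Pi_iff)
  ultimately obtain t s where run: "exec n g T minimize (init_state n d) t s"
    and t: "t \<le> 200 * (n ^ d * T + n ^ (2 * d + 1))" and inc: "oracle_machine.incumbent n g s"
    and least: "\<And>I. I \<subseteq> {..<n} \<Longrightarrow> I \<noteq> {} \<Longrightarrow> var s ''value'' \<le> g I"
    using oracle_machine.wp_minimize[OF n, of g d T] by (auto simp: oracle_machine.wp_def)
  define X where "X = (!) xs ` stored_set n s ''X''"
  have X: "X \<noteq> {}" "X \<subseteq> V" "var s ''value'' = f X"
    using inc stored_set_subset[of n s "''X''"] img
    by (auto simp: X_def oracle_machine.incumbent_def g_def)
  have "f X \<le> f Y" if Y: "Y \<noteq> {}" "Y \<subseteq> V" for Y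
  proof -
    obtain I where "I \<subseteq> {..<n}" "Y = (!) xs ` I"
      using Y(2) img by (metis subset_imageE)
    then show ?thesis using least[of I] Y(1) X(3) by (auto simp: g_def)
  qed
  moreover have "finite {f Y |Y. Y \<noteq> {} \<and> Y \<subseteq> V}"
    using V(1) by (intro finite_image_set) simp
  ultimately have "f X = Min {f Y |Y. Y \<noteq> {} \<and> Y \<subseteq> V}"
    using X by (intro Min_eqI[symmetric]) auto
  with run t X show "\<exists>t s X. exec n (\<lambda>I. f ((!) xs ` I)) T minimize (init_state n d) t s \<and>
      X = (!) xs ` stored_set n s ''X'' \<and> X \<noteq> {} \<and> X \<subseteq> V \<and>
      f X = Min {f Y |Y. Y \<noteq> {} \<and> Y \<subseteq> V} \<and> var s ''value'' = f X \<and>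
      t \<le> 200 * (n ^ d * T + n ^ (2 * d + 1))"
    unfolding X_def g_def by blast
qed

end
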